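(* Let $\mathbb{B}_0=(X_1,X_2,X_3)$ be the basis of the Lie algebra $\mathfrak{sol}$ of $\mathrm{Sol}$ with $[X_1,X_2]=X_2$, $[X_1,X_3]=-X_3$, $[X_2,X_3]=0$. Let $u>0$, $v>0$ and consider the left invariant metric on $\mathrm{Sol}$ with matrix in $\mathbb{B}_0$ $$\begin{pmatrix}\frac1{u+v}&0&0\\0&-\frac vu&1\\0&1&1\end{pmatrix}.$$ Its Ricci curvature and scalar curvature are $$M(\mathrm{ric},\mathbb{B}_0)=\begin{pmatrix}-\frac{2v}{v+u}&0&0\\0&2v&2v\\0&2v&-2u\end{pmatrix},\qquad\mathfrak{s}=-2v.$$ The Ricci curvature has signature $(+,-,-)$ and the Ricci operator is of type $\{az\bar z\}$.
   Context: $\mathrm{Sol}$ is the simply connected Lie group with Lie algebra $\mathfrak{sol}$. A left invariant metric on a Lie group with Lie algebra $\mathfrak{g}$ is identified with a nondegenerate symmetric bilinear form $\langle\,,\rangle$ on $\mathfrak{g}$. The Levi-Civita product $\mathrm{L}:\mathfrak{g}\times\mathfrak{g}\to\mathfrak{g}$ is given by $2\langle\mathrm{L}_uv,w\rangle=\langle[u,v],w\rangle+\langle[w,u],v\rangle+\langle[w,v],u\rangle$, the curvature by $\mathrm{K}(u,v)=\mathrm{L}_{[u,v]}-[\mathrm{L}_u,\mathrm{L}_v]$, the Ricci tensor by $\mathrm{ric}(u,v)=\mathrm{tr}(w\mapsto\mathrm{K}(u,w)v)$, the Ricci operator by $\langle\mathrm{Ric}(u),v\rangle=\mathrm{ric}(u,v)$,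 and the scalar curvature by $\mathfrak{s}=\mathrm{tr}(\mathrm{Ric})$. $M(\mathrm{ric},\mathbb{B}_0)$ is the Gram matrix of $\mathrm{ric}$ in $\mathbb{B}_0$. The signature of $\mathrm{ric}$ is its signature as a symmetric bilinear form (signs listed in any order). A symmetric endomorphism of a three dimensional Lorentzian vector space is of type $\{az\bar z\}$ if it has one real eigenvalue and two non-real complex conjugate eigenvalues. *)

theory Defs
  imports "HOL-Analysis.Analysis"
begin

text \<open>
  Real Lie algebras of dimension \<open>CARD('n)\<close> are given by a bracket on the underlying vector
  space \<open>real ^ 'n\<close>. The standard inner product and the standard basis of \<open>real ^ 'n\<close> have no
  geometric meaning here; they enter only through \<^const>\<open>matrix\<close>, which is used for notions
  (trace, complex eigenvalues) that do not depend on the choice of a basis.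
\<close>

definition lie_bracket :: "(real ^ 'n \<Rightarrow> real ^ 'n \<Rightarrow> real ^ 'n) \<Rightarrow> bool" where
  "lie_bracket br \<longleftrightarrow>
     bilinear br \<and> (\<forall>x. br x x = 0) \<and>
     (\<forall>x y z. br x (br y z) + br y (br z x) + br z (br x y) = 0)"

definition is_basis :: "('n \<Rightarrow> real ^ 'n) \<Rightarrow> bool" where
  "is_basis X \<longleftrightarrow> inj X \<and> independent (range X) \<and> span (range X) = UNIV"

definition symmetric_bilinear_form :: "(real ^ 'n \<Rightarrow> real ^ 'n \<Rightarrow> real) \<Rightarrow> bool" where
  "symmetric_bilinear_form b \<longleftrightarrow> bilinear b \<and> (\<forall>x y. b x y = b y x)"

text \<open>A left invariant pseudo-Riemannian metric on a Lie group, as a form on its Lie algebra.\<close>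

definition left_invariant_metric :: "(real ^ 'n \<Rightarrow> real ^ 'n \<Rightarrow> real) \<Rightarrow> bool" where
  "left_invariant_metric g \<longleftrightarrow>
     symmetric_bilinear_form g \<and> (\<forall>x. (\<forall>y. g x y = 0) \<longrightarrow> x = 0)"

definition gram_matrix ::
    "(real ^ 'n \<Rightarrow> real ^ 'n \<Rightarrow> real) \<Rightarrow> ('n \<Rightarrow> real ^ 'n) \<Rightarrow> real ^ 'n ^ 'n" where
  "gram_matrix b X = (\<chi> i j. b (X i) (X j))"

text \<open>
  The two definite descriptions below denote the intended vector whenever \<open>g\<close> is a
  left invariant metric: existence and uniqueness are exactly its nondegeneracy.
\<close>

definition levi_civita ::
    "(real ^ 'n \<Rightarrow> real ^ 'n \<Rightarrow> real ^ 'n) \<Rightarrow> (real ^ 'n \<Rightarrow> real ^ 'n \<Rightarrow> real) \<Rightarrow>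
      real ^ 'n \<Rightarrow> real ^ 'n \<Rightarrow> real ^ 'n" where
  "levi_civita br g u v =
     (THE l. \<forall>w. 2 * g l w = g (br u v) w + g (br w u) v + g (br w v) u)"

definition curvature ::
    "(real ^ 'n \<Rightarrow> real ^ 'n \<Rightarrow> real ^ 'n) \<Rightarrow> (real ^ 'n \<Rightarrow> real ^ 'n \<Rightarrow> real) \<Rightarrow>
      real ^ 'n \<Rightarrow> real ^ 'n \<Rightarrow> real ^ 'n \<Rightarrow> real ^ 'n" where
  "curvature br g u v w =
     (let L = levi_civita br g in L (br u v) w - (L u (L v w) - L v (L u w)))"

definition ricci ::
    "(real ^ 'n \<Rightarrow> real ^ 'n \<Rightarrow> real ^ 'n) \<Rightarrow> (real ^ 'n \<Rightarrow> real ^ 'n \<Rightarrow> real) \<Rightarrow>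
      real ^ 'n \<Rightarrow> real ^ 'n \<Rightarrow> real" where
  "ricci br g u v = trace (matrix (\<lambda>w. curvature br g u w v))"

definition ricci_operator ::
    "(real ^ 'n \<Rightarrow> real ^ 'n \<Rightarrow> real ^ 'n) \<Rightarrow> (real ^ 'n \<Rightarrow> real ^ 'n \<Rightarrow> real) \<Rightarrow>
      real ^ 'n \<Rightarrow> real ^ 'n" where
  "ricci_operator br g u = (THE r. \<forall>v. g r v = ricci br g u v)"

definition scalar_curvature ::
    "(real ^ 'n \<Rightarrow> real ^ 'n \<Rightarrow> real ^ 'n) \<Rightarrow> (real ^ 'n \<Rightarrow> real ^ 'n \<Rightarrow> real) \<Rightarrow> real" where
  "scalar_curvature br g = trace (matrix (ricci_operator br g))"

text \<open>
  \<open>p\<close> plus signs and \<open>q\<close> minus signs in some diagonalizing basis; by Sylvester's law of inertia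
  \<open>p\<close> and \<open>q\<close> are determined by \<open>b\<close>. The form is nondegenerate iff \<open>p + q = CARD('n)\<close>.
\<close>

definition has_signature :: "(real ^ 'n \<Rightarrow> real ^ 'n \<Rightarrow> real) \<Rightarrow> nat \<Rightarrow> nat \<Rightarrow> bool" where
  "has_signature b p q \<longleftrightarrow>
     symmetric_bilinear_form b \<and>
     (\<exists>E. is_basis E \<and>
          (\<forall>i j. i \<noteq> j \<longrightarrow> b (E i) (E j) = 0) \<and>
          card {i. b (E i) (E i) > 0} = p \<and>
          card {i. b (E i) (E i) < 0} = q)"

text \<open>Eigenvalues of the complexification of a real endomorphism.\<close>

definition complex_eigenvalue :: "(real ^ 'n \<Rightarrow> real ^ 'n) \<Rightarrow> complex \<Rightarrow> bool" where
  "complex_eigenvalue f c \<longleftrightarrow>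
     (\<exists>x. x \<noteq> 0 \<and> map_matrix complex_of_real (matrix f) *v x = c *s x)"

text \<open>
  Symmetric endomorphisms of type \<open>{a, z, cnj z}\<close> of a three dimensional Lorentzian vector space
  (one minus sign). The three eigenvalues are distinct, so in dimension three each is simple.
\<close>

definition type_azzbar :: "(real ^ 3 \<Rightarrow> real ^ 3 \<Rightarrow> real) \<Rightarrow> (real ^ 3 \<Rightarrow> real ^ 3) \<Rightarrow> bool" where
  "type_azzbar g f \<longleftrightarrow>
     has_signature g 2 1 \<and>
     linear f \<and> (\<forall>x y. g (f x) y = g x (f y)) \<and>
     (\<exists>a :: real. \<exists>z :: complex. z \<notin> \<real> \<and>
        {c. complex_eigenvalue f c} = {complex_of_real a, z, cnj z})"

definition sol_basis :: "(real ^ 3 \<Rightarrow> real ^ 3 \<Rightarrow> real ^ 3) \<Rightarrow> (3 \<Rightarrow> real ^ 3) \<Rightarrow> bool" where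
  "sol_basis br X \<longleftrightarrow>
     lie_bracket br \<and> is_basis X \<and>
     br (X 1) (X 2) = X 2 \<and> br (X 1) (X 3) = - X 3 \<and> br (X 2) (X 3) = 0"

lemma sol_basis_exists: "\<exists>br X. sol_basis br X"
proof -
  let ?br = "\<lambda>x y :: real ^ 3. vector [0, x$1 * y$2 - x$2 * y$1, x$3 * y$1 - x$1 * y$3] :: real ^ 3"
  let ?X = "\<lambda>i. axis i 1 :: real ^ 3"
  have "lie_bracket ?br"
    unfolding lie_bracket_def bilinear_def
    by (auto simp: vec_eq_iff forall_3 algebra_simps intro!: linearI)
  moreover have "range ?X = Basis"
    by (auto simp: Basis_vec_def)
  then have "is_basis ?X"
    by (auto simp: is_basis_def inj_on_def axis_eq_axis independent_Basis)
  moreover have "?br (?X 1) (?X 2) = ?X 2" "?br (?X 1) (?X 3) = - ?X 3" "?br (?X 2) (?X 3) = 0"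
    by (simp_all add: vec_eq_iff forall_3 axis_def)
  ultimately show ?thesis
    unfolding sol_basis_def by blast
qed

end

theory Submission
  imports Defs
begin

text \<open>
  Nondegeneracy makes the Levi-Civita product bilinear and determined by the Koszul formula on
  \<open>X\<close>; from its nine values one reads off the curvature, hence the Ricci form. In the basis \<open>X\<close>
  the Ricci operator is \<open>X\<^sub>1 \<mapsto> -2v X\<^sub>1\<close>, \<open>X\<^sub>2 \<mapsto> 2v X\<^sub>3\<close>, \<open>X\<^sub>3 \<mapsto> -2u X\<^sub>2\<close>, so its square on the plane of
  \<open>X\<^sub>2, X\<^sub>3\<close> is \<open>-4uv\<close>, which gives the eigenvalues \<open>-2v\<close> and \<open>\<plusminus>2i\<surd>(uv)\<close>. The bases
  \<open>X\<^sub>1, X\<^sub>2, X\<^sub>3 - X\<^sub>2\<close> and \<open>X\<^sub>1, X\<^sub>3, X\<^sub>2 - X\<^sub>3\<close> diagonalize the Ricci form and the metric.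
\<close>

section \<open>Bases\<close>

text \<open>A spanning set has at least \<open>CARD('n)\<close> elements, and the range of a family
  over \<open>'n\<close> has at most that many, so spanning forces injectivity and
  independence.\<close>

lemma is_basisI:
  fixes X :: "'n::finite \<Rightarrow> real ^ 'n"
  assumes "span (range X) = UNIV"
  shows "is_basis X"
proof -
  have d: "dim (range X) = CARD('n)"
    using assms by (metis dim_span dim_UNIV DIM_cart DIM_real mult.right_neutral)
  have "card (range X) \<le> CARD('n)"
    by (rule card_image_le) simp
  moreover have "dim (range X) \<le> card (range X)"
    by (rule dim_le_card) (auto intro: span_base)
  ultimately have c: "card (range X) = CARD('n)"
    using d by simp
  then have "inj X"
    by (intro eq_card_imp_inj_on) simp_all
  moreover have "independent (range X)"
    using c d by (intro card_le_dim_spanning[of _ UNIV]) (use assms in auto)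
  ultimately show ?thesis
    using assms by (simp add: is_basis_def)
qed

lemma linear_eq_on_basis:
  assumes "is_basis X" "linear f" "linear h" "\<And>i. f (X i) = h (X i)"
  shows "f x = h x"
  using assms linear_eq_on_span[of f h "range X" x] by (auto simp: is_basis_def)

lemma bilinear_eq_on_basis:
  assumes "is_basis X" "bilinear b" "bilinear b'" "\<And>i j. b (X i) (X j) = b' (X i) (X j)"
  shows "b x y = b' x y"
proof (rule linear_eq_on_basis[of X "b x" "b' x"])
  fix j
  show "b x (X j) = b' x (X j)"
    by (rule linear_eq_on_basis[of X "\<lambda>x. b x (X j)" "\<lambda>x. b' x (X j)"])
      (use assms in \<open>auto simp: bilinear_def\<close>)
qed (use assms in \<open>auto simp: bilinear_def\<close>)

section \<open>Transition matrices; trace and complex eigenvalues in an arbitrary basis\<close>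

definition basis_matrix :: "('n \<Rightarrow> real ^ 'n) \<Rightarrow> real ^ 'n ^ 'n" where
  "basis_matrix X = (\<chi> i j. X j $ i)"

lemma basis_matrix_inverse:
  assumes "is_basis X"
  obtains Q where "Q ** basis_matrix X = mat 1" "basis_matrix X ** Q = mat 1"
proof -
  have "columns (basis_matrix X) = range X"
    by (auto simp: columns_def column_def basis_matrix_def)
  then have "span (columns (basis_matrix X)) = UNIV"
    using assms by (simp add: is_basis_def)
  then obtain Q where "basis_matrix X ** Q = mat 1"
    using matrix_right_invertible_span_columns[of "basis_matrix X"]
    by (auto simp: span_vec_eq)
  then show ?thesis
    using matrix_left_right_inverse that by blast
qed

text \<open>Column \<open>j\<close> of either product is \<open>f (X j)\<close>; once
  \<open>basis_matrix X\<close> is inverted this says that \<open>matrix f\<close> and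
  \<open>A\<close> are similar.\<close>

lemma matrix_change_of_basis:
  assumes "linear f" "\<And>j. f (X j) = (\<Sum>i\<in>UNIV. A $ i $ j *\<^sub>R X i)"
  shows "matrix f ** basis_matrix X = basis_matrix X ** A"
proof -
  have "(matrix f ** basis_matrix X) $ i $ j = (basis_matrix X ** A) $ i $ j" for i j
  proof -
    have "(matrix f ** basis_matrix X) $ i $ j = (matrix f *v X j) $ i"
      by (simp add: matrix_matrix_mult_def matrix_vector_mult_def basis_matrix_def)
    also have "\<dots> = f (X j) $ i"
      using assms(1) by (simp add: matrix_works linear_matrix_vector_mul_eq)
    finally show ?thesis
      by (simp add: assms(2) matrix_matrix_mult_def basis_matrix_def mult.commute)
  qed
  then show ?thesis
    by (simp add: vec_eq_iff)
qed

text \<open>\<open>matrix f\<close> is the conjugate of \<open>A\<close> by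
  \<open>basis_matrix X\<close>, and the trace allows cyclic permutation of factors.\<close>

lemma trace_in_basis:
  assumes "is_basis X" "linear f" "\<And>j. f (X j) = (\<Sum>i\<in>UNIV. A $ i $ j *\<^sub>R X i)"
  shows "trace (matrix f) = trace A"
proof -
  obtain Q where Q: "Q ** basis_matrix X = mat 1" "basis_matrix X ** Q = mat 1"
    using basis_matrix_inverse[OF assms(1)] .
  have "matrix f = (basis_matrix X ** A) ** Q"
    using matrix_change_of_basis[OF assms(2,3)] Q
    by (metis matrix_mul_assoc matrix_mul_rid)
  then show ?thesis
    by (metis Q(1) matrix_mul_assoc matrix_mul_lid trace_mul_sym)
qed

lemma map_matrix_of_real_mult:
  "map_matrix complex_of_real (A ** B) = map_matrix complex_of_real A ** map_matrix complex_of_real B"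
  by (simp add: vec_eq_iff matrix_matrix_mult_def map_matrix_def)

lemma map_matrix_of_real_mat_1: "map_matrix complex_of_real (mat 1) = mat 1"
  by (simp add: vec_eq_iff mat_def map_matrix_def)

text \<open>The similarity persists over the complex numbers because the entrywise embedding
  respects products; \<open>Q'\<close> and \<open>P'\<close> carry eigenvectors back and forth and
  keep the eigenvalue.\<close>

lemma complex_eigenvalue_in_basis:
  assumes "is_basis X" "linear f" "\<And>j. f (X j) = (\<Sum>i\<in>UNIV. A $ i $ j *\<^sub>R X i)"
  shows "complex_eigenvalue f c \<longleftrightarrow> (\<exists>x. x \<noteq> 0 \<and> map_matrix complex_of_real A *v x = c *s x)"
proof -
  obtain Q where "Q ** basis_matrix X = mat 1" "basis_matrix X ** Q = mat 1"
    using basis_matrix_inverse[OF assms(1)] .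
  moreover define P' Q' F A' where "P' = map_matrix complex_of_real (basis_matrix X)"
    and "Q' = map_matrix complex_of_real Q"
    and "F = map_matrix complex_of_real (matrix f)"
    and "A' = map_matrix complex_of_real A"
  ultimately have PQ: "Q' ** P' = mat 1" "P' ** Q' = mat 1" "F ** P' = P' ** A'"
    using matrix_change_of_basis[OF assms(2,3)]
    by (metis map_matrix_of_real_mult map_matrix_of_real_mat_1)+
  then have FA: "Q' ** F = A' ** Q'"
    by (metis matrix_mul_assoc matrix_mul_lid matrix_mul_rid)
  have "(\<exists>x. x \<noteq> 0 \<and> F *v x = c *s x) \<longleftrightarrow> (\<exists>x. x \<noteq> 0 \<and> A' *v x = c *s x)"
  proof safe
    fix x assume "x \<noteq> 0" "F *v x = c *s x"
    then have "A' *v (Q' *v x) = c *s (Q' *v x)"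
      by (metis FA matrix_vector_mul_assoc vector_scalar_commute)
    moreover have "Q' *v x \<noteq> 0"
      using \<open>x \<noteq> 0\<close> PQ(2) by (metis matrix_vector_mul_assoc matrix_vector_mul_lid matrix_vector_mult_0_right)
    ultimately show "\<exists>x. x \<noteq> 0 \<and> A' *v x = c *s x"
      by blast
  next
    fix x assume "x \<noteq> 0" "A' *v x = c *s x"
    then have "F *v (P' *v x) = c *s (P' *v x)"
      by (metis PQ(3) matrix_vector_mul_assoc vector_scalar_commute)
    moreover have "P' *v x \<noteq> 0"
      using \<open>x \<noteq> 0\<close> PQ(1) by (metis matrix_vector_mul_assoc matrix_vector_mul_lid matrix_vector_mult_0_right)
    ultimately show "\<exists>x. x \<noteq> 0 \<and> F *v x = c *s x"
      by blast
  qed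
  then show ?thesis
    by (simp add: complex_eigenvalue_def F_def A'_def)
qed

lemma trace_matrix_add:
  "trace (matrix (\<lambda>w. f w + h w)) = trace (matrix f) + trace (matrix h)"
  by (simp add: trace_def matrix_def sum.distrib)

lemma trace_matrix_scaleR:
  "trace (matrix (\<lambda>w. c *\<^sub>R f w)) = c * trace (matrix f)"
  by (simp add: trace_def matrix_def sum_distrib_left)

section \<open>Metrics, Levi-Civita product and Ricci curvature\<close>

lemma left_invariant_metricD:
  assumes "left_invariant_metric g"
  shows "bilinear g" "g x y = g y x" "(\<And>w. g x w = g y w) \<Longrightarrow> x = y"
proof -
  show g: "bilinear g" and "g x y = g y x"
    using assms by (auto simp: left_invariant_metric_def symmetric_bilinear_form_def)
  assume "\<And>w. g x w = g y w"
  then have "\<forall>w. g (x - y) w = 0"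
    using g by (simp add: bilinear_lsub)
  then show "x = y"
    using assms by (auto simp: left_invariant_metric_def)
qed

text \<open>Nondegeneracy makes the map from \<open>x\<close> to the values of \<open>g x\<close> on
  the standard basis injective, hence surjective by dimension. This settles the definite
  descriptions in \<open>levi_civita\<close> and \<open>ricci_operator\<close>.\<close>

lemma left_invariant_metric_represents:
  fixes \<phi> :: "real ^ 'n \<Rightarrow> real"
  assumes "left_invariant_metric g" "linear \<phi>"
  shows "\<exists>!l. \<forall>w. g l w = \<phi> w"
proof -
  note g = left_invariant_metricD[OF assms(1)]
  let ?T = "\<lambda>x. \<chi> k. g x (axis k 1)"
  have lin: "linear ?T"
    by (rule linearI) (auto simp: vec_eq_iff g(1) bilinear_ladd bilinear_lmul)
  have eq: "\<forall>w. g x w = \<psi> w" if "linear \<psi>" "\<And>k. g x (axis k 1) = \<psi> (axis k 1)" for x \<psi>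
  proof -
    have "linear (g x)"
      using g(1) by (simp add: bilinear_def)
    then have "g x = \<psi>"
      by (rule linear_eq_stdbasis) (use that in \<open>auto simp: Basis_vec_def\<close>)
    then show ?thesis
      by simp
  qed
  have "inj ?T"
  proof (rule injI)
    fix x y assume "?T x = ?T y"
    then have "\<forall>w. g x w = g y w"
      using g(1) by (intro eq) (auto simp: vec_eq_iff bilinear_def)
    then show "x = y"
      using g(3) by blast
  qed
  then have "surj ?T"
    using lin linear_injective_imp_surjective by blast
  then obtain l where "(\<chi> k. \<phi> (axis k 1)) = ?T l"
    by (rule surjE)
  then have "\<forall>w. g l w = \<phi> w"
    by (intro eq assms) (simp add: vec_eq_iff)
  then show ?thesis
    by (intro ex1I[of _ l] g(3)) simp_all
qed

lemma levi_civita_koszul: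
  assumes "bilinear br" "left_invariant_metric g"
  shows "2 * g (levi_civita br g u v) w = g (br u v) w + g (br w u) v + g (br w v) u"
proof -
  note g = left_invariant_metricD[OF assms(2)]
  let ?\<phi> = "\<lambda>w. (g (br u v) w + g (br w u) v + g (br w v) u) / 2"
  have "linear ?\<phi>"
    by (rule linearI)
      (auto simp: g(1) assms(1) bilinear_ladd bilinear_lmul bilinear_radd bilinear_rmul field_simps)
  then have "\<exists>!l. \<forall>w. g l w = ?\<phi> w"
    by (rule left_invariant_metric_represents[OF assms(2)])
  then have "\<exists>!l. \<forall>w. 2 * g l w = g (br u v) w + g (br w u) v + g (br w v) u"
    by (simp add: field_simps)
  from theI'[OF this] show ?thesis
    unfolding levi_civita_def by blast
qed

lemma levi_civita_eqI:
  assumes "bilinear br" "left_invariant_metric g"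
    and "\<And>w. 2 * g l w = g (br u v) w + g (br w u) v + g (br w v) u"
  shows "levi_civita br g u v = l"
proof (rule left_invariant_metricD(3)[OF assms(2)])
  show "g (levi_civita br g u v) w = g l w" for w
    using levi_civita_koszul[OF assms(1,2), of u v w] assms(3)[of w] by simp
qed

text \<open>Both sides of the Koszul formula are linear in \<open>w\<close>, so a guessed value of
  the product needs testing on basis vectors only.\<close>

lemma levi_civita_eq_on_basisI:
  assumes "bilinear br" "left_invariant_metric g" "is_basis X"
    and "\<And>k. 2 * g l (X k) = g (br u v) (X k) + g (br (X k) u) v + g (br (X k) v) u"
  shows "levi_civita br g u v = l"
proof (rule levi_civita_eqI[OF assms(1,2)])
  note g = left_invariant_metricD(1)[OF assms(2)]
  show "2 * g l w = g (br u v) w + g (br w u) v + g (br w v) u" for w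
    by (rule linear_eq_on_basis[OF assms(3), of "\<lambda>w. 2 * g l w", OF _ _ assms(4)]; rule linearI)
      (auto simp: g assms(1) bilinear_ladd bilinear_lmul bilinear_radd bilinear_rmul field_simps)
qed

text \<open>By nondegeneracy it suffices to pair with an arbitrary \<open>w\<close>, and the Koszul
  expression is bilinear in \<open>u\<close> and \<open>v\<close>.\<close>

lemma bilinear_levi_civita:
  assumes "bilinear br" "left_invariant_metric g"
  shows "bilinear (levi_civita br g)"
proof -
  note g = left_invariant_metricD(1)[OF assms(2)]
  note K = levi_civita_koszul[OF assms]
  note bs = g assms(1) bilinear_ladd bilinear_lmul bilinear_radd bilinear_rmul
  have K': "g (levi_civita br g u v) w = (g (br u v) w + g (br w u) v + g (br w v) u) / 2" for u v w
    using K[of u v w] by simp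
  show ?thesis
    unfolding bilinear_def
    by (safe; rule linearI; rule left_invariant_metricD(3)[OF assms(2)])
      (simp_all add: bs K' field_simps)
qed

section \<open>Symmetries of the curvature; Ricci form and Ricci operator\<close>

lemma curvature_linear:
  assumes "bilinear br" "left_invariant_metric g"
  shows "linear (\<lambda>x. curvature br g x y z)" "linear (\<lambda>y. curvature br g x y z)"
    "linear (\<lambda>z. curvature br g x y z)"
  by (rule linearI; simp add: curvature_def Let_def assms(1) bilinear_levi_civita[OF assms]
      bilinear_ladd bilinear_lmul bilinear_radd bilinear_rmul algebra_simps)+

lemma lie_bracket_skew:
  assumes "lie_bracket br"
  shows "br y x = - br x y"
proof -
  have br: "bilinear br" "\<And>x. br x x = 0"
    using assms by (auto simp: lie_bracket_def)
  have "br (x + y) (x + y) = br x x + br y y + (br x y + br y x)"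
    by (simp only: br(1) bilinear_ladd bilinear_radd) simp
  then show ?thesis
    by (simp add: br(2) eq_neg_iff_add_eq_0 add.commute)
qed

text \<open>Swapping \<open>x\<close> and \<open>y\<close> changes the sign of the bracket and of
  the commutator. In dimension three this cuts the curvature values to be computed on a basis from
  27 to nine.\<close>

lemma curvature_skew:
  assumes "lie_bracket br" "left_invariant_metric g"
  shows "curvature br g y x z = - curvature br g x y z" "curvature br g x x z = 0"
proof -
  have br: "bilinear br" "\<And>x. br x x = 0"
    using assms(1) by (auto simp: lie_bracket_def)
  have "br y x = - br x y"
    by (rule lie_bracket_skew[OF assms(1)])
  with br show "curvature br g y x z = - curvature br g x y z" "curvature br g x x z = 0"
    by (simp_all add: curvature_def Let_def bilinear_levi_civita[OF br(1) assms(2)]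
        bilinear_lneg bilinear_lzero)
qed

lemma bilinear_ricci:
  assumes "bilinear br" "left_invariant_metric g"
  shows "bilinear (ricci br g)"
proof -
  note c = curvature_linear[OF assms]
  show ?thesis
    unfolding bilinear_def ricci_def
    by (safe; rule linearI)
      (simp_all add: linear_add[OF c(1)] linear_add[OF c(3)] linear_scale[OF c(1)]
        linear_scale[OF c(3)] trace_matrix_add trace_matrix_scaleR)
qed

lemma ricci_operator_works:
  assumes "bilinear br" "left_invariant_metric g"
  shows "g (ricci_operator br g x) y = ricci br g x y"
proof -
  have "\<exists>!r. \<forall>y. g r y = ricci br g x y"
    using bilinear_ricci[OF assms]
    by (intro left_invariant_metric_represents assms) (simp add: bilinear_def)
  from theI'[OF this] show ?thesis
    unfolding ricci_operator_def by blast
qed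

lemma linear_ricci_operator:
  assumes "bilinear br" "left_invariant_metric g"
  shows "linear (ricci_operator br g)"
  by (rule linearI; rule left_invariant_metricD(3)[OF assms(2)])
    (simp_all add: left_invariant_metricD(1)[OF assms(2)] bilinear_ladd bilinear_lmul
      ricci_operator_works[OF assms] bilinear_ricci[OF assms])

lemma ricci_operator_eq_on_basisI:
  assumes "bilinear br" "left_invariant_metric g" "is_basis X"
    and "\<And>k. g r (X k) = ricci br g x (X k)"
  shows "ricci_operator br g x = r"
proof (rule left_invariant_metricD(3)[OF assms(2)])
  fix w
  have "g r w = ricci br g x w"
    by (rule linear_eq_on_basis[OF assms(3), of "g r", OF _ _ assms(4)])
      (use left_invariant_metricD(1)[OF assms(2)] bilinear_ricci[OF assms(1,2)]
        in \<open>auto simp: bilinear_def\<close>)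
  then show "g (ricci_operator br g x) w = g r w"
    by (simp add: ricci_operator_works[OF assms(1,2)])
qed

text \<open>The span of \<open>x, y, z\<close> contains a basis, so these three vectors form a basis
  themselves; symmetry supplies the other half of the orthogonality relations.\<close>

lemma has_signature_3I:
  fixes b :: "real ^ 3 \<Rightarrow> real ^ 3 \<Rightarrow> real"
  assumes "symmetric_bilinear_form b" "is_basis X" "range X \<subseteq> span {x, y, z}"
    and "b x y = 0" "b x z = 0" "b y z = 0"
    and "p = card {i::3. b (vector [x, y, z] $ i) (vector [x, y, z] $ i) > 0}"
    and "q = card {i::3. b (vector [x, y, z] $ i) (vector [x, y, z] $ i) < 0}"
  shows "has_signature b p q"
proof -
  define E :: "3 \<Rightarrow> real ^ 3" where "E = (\<lambda>i. (vector [x, y, z] :: (real ^ 3) ^ 3) $ i)"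
  have E: "E 1 = x" "E 2 = y" "E 3 = z"
    by (simp_all add: E_def)
  then have "range E = {x, y, z}"
    by (auto simp: UNIV_3)
  then have "is_basis E"
    using assms(2,3) span_minimal[of "range X" "span (range E)"]
    by (intro is_basisI) (auto simp: is_basis_def)
  moreover have "b (E i) (E j) = 0" if "i \<noteq> j" for i j
  proof -
    have "b y x = 0" "b z x = 0" "b z y = 0"
      using assms(1,4-6) by (simp_all add: symmetric_bilinear_form_def)
    then show ?thesis
      using that assms(4-6) exhaust_3[of i] exhaust_3[of j] by (elim disjE) (simp_all add: E)
  qed
  ultimately show ?thesis
    unfolding has_signature_def using assms(1,7,8)
    by (intro conjI exI[of _ E]) (simp_all add: E_def)
qed

section \<open>The metric on Sol\<close>

theorem proposition4p12:
  fixes br :: "real ^ 3 \<Rightarrow> real ^ 3 \<Rightarrow> real ^ 3"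
    and X :: "3 \<Rightarrow> real ^ 3"
    and g :: "real ^ 3 \<Rightarrow> real ^ 3 \<Rightarrow> real"
    and u v :: real
  assumes "sol_basis br X"
    and "u > 0" and "v > 0"
    and "left_invariant_metric g"
    and "gram_matrix g X =
           vector [vector [1 / (u + v), 0, 0],
                   vector [0, - (v / u), 1],
                   vector [0, 1, 1]]"
  shows "gram_matrix (ricci br g) X =
           vector [vector [- (2 * v / (v + u)), 0, 0],
                   vector [0, 2 * v, 2 * v],
                   vector [0, 2 * v, - (2 * u)]]
         \<and> scalar_curvature br g = - (2 * v)
         \<and> has_signature (ricci br g) 1 2
         \<and> type_azzbar g (ricci_operator br g)"
proof -

  \<comment> \<open>Brackets and Gram matrix in the basis \<open>X\<close>\<close>
  define s where "s = u + v"
  have s: "s > 0" "u > 0" "v > 0"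
    using assms(2,3) by (auto simp: s_def)
  note nz = s[THEN less_imp_neq, symmetric]
  have nz': "u + v \<noteq> 0" "v + u \<noteq> 0" "u \<noteq> 0" "v \<noteq> 0"
    using s by auto
  have lie: "lie_bracket br" and X: "is_basis X"
    and br0: "br (X 1) (X 2) = X 2" "br (X 1) (X 3) = - X 3" "br (X 2) (X 3) = 0"
    using assms(1) by (auto simp: sol_basis_def)
  have br: "bilinear br" and alt: "\<And>x. br x x = 0"
    using lie by (auto simp: lie_bracket_def)
  note skew = lie_bracket_skew[OF lie]
  have br': "br (X 2) (X 1) = - X 2" "br (X 3) (X 1) = X 3" "br (X 3) (X 2) = 0"
    using skew[of "X 2" "X 1"] skew[of "X 3" "X 1"] skew[of "X 3" "X 2"] by (simp_all add: br0)
  note m = assms(4)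
  note g = left_invariant_metricD(1)[OF m]
  have "\<And>i j. g (X i) (X j) = gram_matrix g X $ i $ j"
    by (simp add: gram_matrix_def)
  then have gX: "g (X 1) (X 1) = 1 / s" "g (X 1) (X 2) = 0" "g (X 1) (X 3) = 0"
    "g (X 2) (X 1) = 0" "g (X 2) (X 2) = - (v / u)" "g (X 2) (X 3) = 1"
    "g (X 3) (X 1) = 0" "g (X 3) (X 2) = 1" "g (X 3) (X 3) = 1"
    by (simp_all add: assms(5) s_def)
  note bl = bilinear_ladd bilinear_radd bilinear_lmul bilinear_rmul bilinear_lsub bilinear_rsub
    bilinear_lneg bilinear_rneg bilinear_lzero bilinear_rzero

  \<comment> \<open>Levi-Civita product\<close>
  define L where "L = levi_civita br g"
  have Lbil: "bilinear L"
    unfolding L_def by (rule bilinear_levi_civita[OF br m])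
  have LI: "L x y = l" if "\<forall>k. 2 * g l (X k) = g (br x y) (X k) + g (br (X k) x) y + g (br (X k) y) x" for x y l
    unfolding L_def using that by (intro levi_civita_eq_on_basisI[OF br m X]) blast
  \<comment> \<open>Each value solves the Koszul equations against \<open>X 1, X 2, X 3\<close>. The
    Gram block of \<open>X 2, X 3\<close> has determinant \<open>- s / u\<close>, whence the
    denominators \<open>s\<close>; since \<open>g (X 1) (X 1) = 1 / s\<close>, the components along
    \<open>X 1\<close> carry a factor \<open>s\<close> instead.\<close>
  have L: "L (X 1) (X 1) = 0"
    "L (X 1) (X 2) = (u / s) *\<^sub>R X 2 + (v / s) *\<^sub>R X 3"
    "L (X 1) (X 3) = (u / s) *\<^sub>R X 2 - (u / s) *\<^sub>R X 3"
    "L (X 2) (X 1) = (v / s) *\<^sub>R X 3 - (v / s) *\<^sub>R X 2"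
    "L (X 2) (X 2) = - (v * s / u) *\<^sub>R X 1"
    "L (X 2) (X 3) = 0"
    "L (X 3) (X 1) = (u / s) *\<^sub>R X 2 + (v / s) *\<^sub>R X 3"
    "L (X 3) (X 2) = 0"
    "L (X 3) (X 3) = - s *\<^sub>R X 1"
    by (rule LI; simp add: forall_3 br0 br' alt g bl gX nz; simp add: s_def nz' divide_simps; simp add: algebra_simps)+

  \<comment> \<open>Curvature\<close>
  have K: "curvature br g (X 1) (X 2) (X 1) = - (v / s) *\<^sub>R X 2 + (2 * v / s) *\<^sub>R X 3"
    "curvature br g (X 1) (X 3) (X 1) = - (2 * u / s) *\<^sub>R X 2 - (v / s) *\<^sub>R X 3"
    "curvature br g (X 2) (X 3) (X 1) = 0"
    "curvature br g (X 1) (X 2) (X 2) = - (v * (s + u) / u) *\<^sub>R X 1"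
    "curvature br g (X 1) (X 2) (X 3) = - v *\<^sub>R X 1"
    "curvature br g (X 1) (X 3) (X 2) = - v *\<^sub>R X 1"
    "curvature br g (X 1) (X 3) (X 3) = (s + u) *\<^sub>R X 1"
    "curvature br g (X 2) (X 3) (X 2) = - v *\<^sub>R X 2 - (v * v / u) *\<^sub>R X 3"
    "curvature br g (X 2) (X 3) (X 3) = - v *\<^sub>R X 2 + v *\<^sub>R X 3"
    unfolding curvature_def Let_def L_def[symmetric]
    \<comment> \<open>Expansion by the table leaves identities between combinations of the
      \<open>X i\<close>; comparing components in \<open>real ^ 3\<close> turns them into identities
      of real fractions.\<close>
    by (simp_all add: br0 Lbil bl L; simp add: vec_eq_iff s_def nz' divide_simps; simp add: algebra_simps)+
  note skewK = curvature_skew[OF lie m]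
  have K': "curvature br g (X 2) (X 1) z = - curvature br g (X 1) (X 2) z"
    "curvature br g (X 3) (X 1) z = - curvature br g (X 1) (X 3) z"
    "curvature br g (X 3) (X 2) z = - curvature br g (X 2) (X 3) z" for z
    by (rule skewK)+

  \<comment> \<open>Ricci form\<close>
  have tr: "ricci br g x y = a11 + a22 + a33"
    if "curvature br g x (X 1) y = a11 *\<^sub>R X 1 + a12 *\<^sub>R X 2 + a13 *\<^sub>R X 3"
      "curvature br g x (X 2) y = a21 *\<^sub>R X 1 + a22 *\<^sub>R X 2 + a23 *\<^sub>R X 3"
      "curvature br g x (X 3) y = a31 *\<^sub>R X 1 + a32 *\<^sub>R X 2 + a33 *\<^sub>R X 3"
    for x y a11 a12 a13 a21 a22 a23 a31 a32 a33
  proof -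
    \<comment> \<open>The image of \<open>X i\<close> has coefficients \<open>ai1, ai2, ai3\<close>;
      images are the columns of the matrix, hence the transposed order.\<close>
    let ?A = "vector [vector [a11, a21, a31], vector [a12, a22, a32], vector [a13, a23, a33]] :: real ^ 3 ^ 3"
    have "\<forall>j. curvature br g x (X j) y = (\<Sum>i\<in>UNIV. ?A $ i $ j *\<^sub>R X i)"
      by (simp add: forall_3 sum_3 that)
    then have "ricci br g x y = trace ?A"
      unfolding ricci_def by (intro trace_in_basis[OF X] curvature_linear[OF br m]) blast
    then show ?thesis
      by (simp add: trace_def sum_3)
  qed
  have ric: "ricci br g (X 1) (X 1) = - (2 * v / s)"
    "ricci br g (X 1) (X 2) = 0" "ricci br g (X 1) (X 3) = 0"
    "ricci br g (X 2) (X 1) = 0" "ricci br g (X 2) (X 2) = 2 * v"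
    "ricci br g (X 2) (X 3) = 2 * v" "ricci br g (X 3) (X 1) = 0"
    "ricci br g (X 3) (X 2) = 2 * v" "ricci br g (X 3) (X 3) = - (2 * u)"
  proof -
    show "ricci br g (X 1) (X 1) = - (2 * v / s)"
      \<comment> \<open>The nine arguments are the coordinates of the images of \<open>X 1\<close>,
        \<open>X 2\<close>, \<open>X 3\<close> in turn, read off \<open>K\<close> up to skew
        symmetry; the same holds for the entries that follow.\<close>
      by (subst tr[of _ _ 0 0 0 0 "- (v / s)" "2 * v / s" 0 "- (2 * u / s)" "- (v / s)"])
        (simp_all add: K skewK(2))
    show "ricci br g (X 1) (X 2) = 0"
      by (subst tr[of _ _ 0 0 0 "- (v * (s + u) / u)" 0 0 "- v" 0 0]) (simp_all add: K skewK(2))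
    show "ricci br g (X 1) (X 3) = 0"
      by (subst tr[of _ _ 0 0 0 "- v" 0 0 "s + u" 0 0]) (simp_all add: K skewK(2))
    show "ricci br g (X 2) (X 1) = 0"
      by (subst tr[of _ _ 0 "v / s" "- (2 * v / s)" 0 0 0 0 0 0]) (simp_all add: K K' skewK(2))
    show "ricci br g (X 2) (X 2) = 2 * v"
      by (subst tr[of _ _ "v * (s + u) / u" 0 0 0 0 0 0 "- v" "- (v * v / u)"])
        (simp_all add: K K' skewK(2), simp add: s_def nz' field_simps)
    show "ricci br g (X 2) (X 3) = 2 * v"
      by (subst tr[of _ _ v 0 0 0 0 0 0 "- v" v]) (simp_all add: K K' skewK(2))
    show "ricci br g (X 3) (X 1) = 0"
      by (subst tr[of _ _ 0 "2 * u / s" "v / s" 0 0 0 0 0 0]) (simp_all add: K K' skewK(2))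
    show "ricci br g (X 3) (X 2) = 2 * v"
      by (subst tr[of _ _ v 0 0 0 v "v * v / u" 0 0 0]) (simp_all add: K K' skewK(2))
    show "ricci br g (X 3) (X 3) = - (2 * u)"
      by (subst tr[of _ _ "- (s + u)" 0 0 0 v "- v" 0 0 0])
        (simp_all add: K K' skewK(2) s_def algebra_simps)
  qed
  have gram: "gram_matrix (ricci br g) X =
      vector [vector [- (2 * v / (v + u)), 0, 0], vector [0, 2 * v, 2 * v],
        vector [0, 2 * v, - (2 * u)]]"
    by (simp add: vec_eq_iff gram_matrix_def forall_3 ric s_def add.commute)

  \<comment> \<open>Symmetry of the Ricci form; Ricci operator and scalar curvature\<close>
  let ?ric = "ricci br g" and ?Ric = "ricci_operator br g"
  note ricbil = bilinear_ricci[OF br m]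
  \<comment> \<open>Symmetry is read off the nine computed values instead of being derived from the
    Bianchi identity.\<close>
  have ricsym: "?ric x y = ?ric y x" for x y
  proof (rule bilinear_eq_on_basis[OF X ricbil])
    show "bilinear (\<lambda>x y. ?ric y x)"
      using ricbil by (simp add: bilinear_def)
    have "\<forall>i j. ?ric (X i) (X j) = ?ric (X j) (X i)"
      by (simp add: forall_3 ric)
    then show "?ric (X i) (X j) = ?ric (X j) (X i)" for i j
      by blast
  qed
  have RI: "?Ric x = r" if "\<forall>k. g r (X k) = ?ric x (X k)" for x r
    using that by (intro ricci_operator_eq_on_basisI[OF br m X]) blast
  \<comment> \<open>Compare rows of the two Gram matrices: row 1 of \<open>?ric\<close> is
    \<open>- (2 * v)\<close> times row 1 of \<open>g\<close>, row 2 is \<open>2 * v\<close> times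
    row 3, and row 3 is \<open>- (2 * u)\<close> times row 2.\<close>
  have R: "?Ric (X 1) = - (2 * v) *\<^sub>R X 1" "?Ric (X 2) = (2 * v) *\<^sub>R X 3"
    "?Ric (X 3) = - (2 * u) *\<^sub>R X 2"
    by (rule RI; simp add: forall_3 g bl gX ric nz)+
  let ?A = "vector [vector [- (2 * v), 0, 0], vector [0, 0, - (2 * u)], vector [0, 2 * v, 0]]
    :: real ^ 3 ^ 3"
  have "\<forall>j. ?Ric (X j) = (\<Sum>i\<in>UNIV. ?A $ i $ j *\<^sub>R X i)"
    by (simp add: forall_3 sum_3 R)
  then have RA: "?Ric (X j) = (\<Sum>i\<in>UNIV. ?A $ i $ j *\<^sub>R X i)" for j
    by blast
  note Rlin = linear_ricci_operator[OF br m]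
  have scal: "scalar_curvature br g = - (2 * v)"
    unfolding scalar_curvature_def trace_in_basis[OF X Rlin RA]
    by (simp add: trace_def sum_3)

  \<comment> \<open>Signatures of the Ricci form and of the metric\<close>
  have rngX: "range X = {X 1, X 2, X 3}"
    by (auto simp: UNIV_3)
  \<comment> \<open>Each equation recovers the basis vector missing from one of the two
    diagonalizing triples.\<close>
  have "X 3 = X 2 + (X 3 - X 2)" "X 2 = X 3 + (X 2 - X 3)"
    by simp_all
  then have span: "range X \<subseteq> span {X 1, X 2, X 3 - X 2}" "range X \<subseteq> span {X 1, X 3, X 2 - X 3}"
    unfolding rngX by (smt (verit) empty_subsetI insertI1 insertI2 insert_subset span_add span_base)+
  have sig_ric: "has_signature ?ric 1 2"
  proof (rule has_signature_3I[OF _ X span(1)])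
    show "symmetric_bilinear_form ?ric"
      using ricbil ricsym by (auto simp: symmetric_bilinear_form_def)
    let ?E = "vector [X 1, X 2, X 3 - X 2] :: (real ^ 3) ^ 3"
    \<comment> \<open>\<open>X 3 - X 2\<close> is orthogonal to \<open>X 2\<close> because
      \<open>?ric (X 2) (X 2) = ?ric (X 2) (X 3)\<close>; its square is
      \<open>- 2 * u - 2 * v\<close>.\<close>
    have sgn: "?ric (X 1) (X 1) < 0" "?ric (X 2) (X 2) > 0" "?ric (X 3 - X 2) (X 3 - X 2) < 0"
      using s by (simp_all add: ricbil bl ric)
    have "{i. ?ric (?E $ i) (?E $ i) > 0} = {2}" "{i. ?ric (?E $ i) (?E $ i) < 0} = {1, 3}"
      using sgn unfolding set_eq_iff mem_Collect_eq by (simp_all add: forall_3)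
    then show "1 = card {i. ?ric (?E $ i) (?E $ i) > 0}" "2 = card {i. ?ric (?E $ i) (?E $ i) < 0}"
      by simp_all
  qed (simp_all add: ricbil bl ric)
  have sig_g: "has_signature g 2 1"
  proof (rule has_signature_3I[OF _ X span(2)])
    show "symmetric_bilinear_form g"
      using m by (simp add: left_invariant_metric_def)
    let ?E = "vector [X 1, X 3, X 2 - X 3] :: (real ^ 3) ^ 3"
    \<comment> \<open>This is the square of \<open>X 2 - X 3\<close>, which is orthogonal to
      \<open>X 3\<close> because \<open>g (X 2) (X 3) = g (X 3) (X 3)\<close>.\<close>
    have "- (v / u) - 1 < 0"
      using divide_pos_pos[OF s(3,2)] by linarith
    then have sgn: "g (X 1) (X 1) > 0" "g (X 3) (X 3) > 0" "g (X 2 - X 3) (X 2 - X 3) < 0"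
      using s by (simp_all add: g bl gX)
    have "{i. g (?E $ i) (?E $ i) > 0} = {1, 2}" "{i. g (?E $ i) (?E $ i) < 0} = {3}"
      using sgn unfolding set_eq_iff mem_Collect_eq by (simp_all add: forall_3)
    then show "2 = card {i. g (?E $ i) (?E $ i) > 0}" "1 = card {i. g (?E $ i) (?E $ i) < 0}"
      by simp_all
  qed (simp_all add: g bl gX)

  \<comment> \<open>Self-adjointness and eigenvalues of the Ricci operator\<close>
  have selfadj: "g (?Ric x) y = g x (?Ric y)" for x y
    using ricci_operator_works[OF br m] ricsym left_invariant_metricD(2)[OF m] by metis
  \<comment> \<open>A square root of \<open>- 4 * u * v\<close>, the scalar by which the square of
    the Ricci operator acts on the plane of \<open>X 2, X 3\<close>; it is not real because
    \<open>u * v > 0\<close>.\<close>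
  define z where "z = \<i> * of_real (2 * sqrt (u * v))"
  let ?u = "complex_of_real u" and ?v = "complex_of_real v"
  have z2: "z * z = - (4 * ?u * ?v)"
    using s by (simp add: z_def complex_eq_iff)
  have zR: "z \<notin> \<real>"
    using s by (simp add: z_def complex_is_Real_iff)
  have ev: "complex_eigenvalue ?Ric c \<longleftrightarrow> c \<in> {complex_of_real (- (2 * v)), z, cnj z}" for c
  proof -
    have eq: "map_matrix complex_of_real ?A *v x = c *s x \<longleftrightarrow>
        - (2 * ?v) * x $ 1 = c * x $ 1 \<and> - (2 * ?u) * x $ 3 = c * x $ 2 \<and> 2 * ?v * x $ 2 = c * x $ 3" for x
      by (simp add: vec_eq_iff matrix_vector_mult_def forall_3 sum_3 map_matrix_def)
    \<comment> \<open>As \<open>z\<close> is purely imaginary, \<open>cnj z = - z\<close>, so the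
      conjugate pair consists of the two square roots of \<open>z * z\<close>.\<close>
    have cz: "c = z \<or> c = cnj z \<longleftrightarrow> c * c = - (4 * ?u * ?v)"
    proof -
      have "cnj z = - z"
        by (simp add: z_def)
      then show ?thesis
        using z2 by (metis square_eq_iff)
    qed
    have "(\<exists>x. x \<noteq> 0 \<and> map_matrix complex_of_real ?A *v x = c *s x) \<longleftrightarrow>
        c = complex_of_real (- (2 * v)) \<or> c * c = - (4 * ?u * ?v)"
    proof (intro iffI; elim exE conjE disjE)
      fix x :: "complex ^ 3"
      assume "x \<noteq> 0" and "map_matrix complex_of_real ?A *v x = c *s x"
      then have x: "- (2 * ?v) * x $ 1 = c * x $ 1" "- (2 * ?u) * x $ 3 = c * x $ 2"
        "2 * ?v * x $ 2 = c * x $ 3"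
        unfolding eq by blast+
      moreover have "x $ 1 \<noteq> 0 \<or> x $ 2 \<noteq> 0 \<or> x $ 3 \<noteq> 0"
        using \<open>x \<noteq> 0\<close> by (auto simp: vec_eq_iff forall_3)
      moreover have "(c + 2 * ?v) * x $ 1 = 0"
        using x(1) by algebra
      \<comment> \<open>Eliminating either coordinate from the last two equations gives the same
        factor; since some coordinate of \<open>x\<close> is nonzero, this factor or
        \<open>c + 2 * ?v\<close> must vanish.\<close>
      moreover have "(c * c + 4 * ?u * ?v) * x $ 2 = 0" "(c * c + 4 * ?u * ?v) * x $ 3 = 0"
        using x(2,3) by algebra+
      ultimately show "c = complex_of_real (- (2 * v)) \<or> c * c = - (4 * ?u * ?v)"
        by (auto simp: eq_neg_iff_add_eq_0)
    next
      assume "c = complex_of_real (- (2 * v))"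
      then have "(vector [1, 0, 0] :: complex ^ 3) \<noteq> 0 \<and>
          map_matrix complex_of_real ?A *v vector [1, 0, 0] = c *s vector [1, 0, 0]"
        unfolding eq by (simp add: vec_eq_iff forall_3)
      then show "\<exists>x. x \<noteq> 0 \<and> map_matrix complex_of_real ?A *v x = c *s x"
        by blast
    next
      assume "c * c = - (4 * ?u * ?v)"
      \<comment> \<open>With these coordinates the third equation holds identically and the second
        becomes the assumption on \<open>c * c\<close>; the vector is nonzero because
        \<open>v > 0\<close>.\<close>
      then have "(vector [0, c, 2 * ?v] :: complex ^ 3) \<noteq> 0 \<and>
          map_matrix complex_of_real ?A *v vector [0, c, 2 * ?v] = c *s vector [0, c, 2 * ?v]"
        unfolding eq using nz by (simp add: vec_eq_iff forall_3)
      then show "\<exists>x. x \<noteq> 0 \<and> map_matrix complex_of_real ?A *v x = c *s x"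
        by blast
    qed
    then show ?thesis
      unfolding complex_eigenvalue_in_basis[OF X Rlin RA] using cz by simp
  qed
  then have "{c. complex_eigenvalue ?Ric c} = {complex_of_real (- (2 * v)), z, cnj z}"
    by blast
  then have "type_azzbar g ?Ric"
    unfolding type_azzbar_def using sig_g Rlin selfadj zR by blast
  with gram scal sig_ric show ?thesis
    by blast
qed

end
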